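(* Every finite connected graph $G$ has a spanning tree $T$ together with an alternating sign $\phi: E(T) \to \{+,-\}$ on $T$.
   Context: For a spanning tree $T$ of a connected graph $G$, a labelling $\phi: E(T)\to\{+,-\}$ is called an alternating sign on $T$ if for every cotree edge $e \in E(G)\setminus E(T)$, the unique path $v_0, v_1, \ldots, v_\ell$ in $T$ joining the two end vertices of $e$ satisfies $\phi(v_i v_{i+1}) \neq \phi(v_{i+1} v_{i+2})$ for all $i = 0, 1, \ldots, \ell-2$ (i.e., consecutive edges along the path receive different signs). *)

theory Defs
  imports "Graph_Theory.Digraph_Component" "Graph_Theory.Vertex_Walk"
begin

text \<open>
  Following the library, a finite simple undirected graph is a finite symmetric digraph without
  loops and parallel arcs (locale \<^locale>\<open>graph\<close>); the undirected edge with ends \<open>u\<close>, \<open>v\<close> is the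
  pair of opposite arcs between them, and is denoted by the set \<open>{u, v}\<close>. The library's
  \<^const>\<open>forest\<close>, \<^const>\<open>tree\<close> and \<^const>\<open>spanning_tree\<close> refer to directed cycles, so that two
  opposite arcs already form a cycle. They are therefore replaced by undirected versions, where
  a cycle has at least three vertices.
\<close>

definition undirected_cycle :: "('a, 'b) pre_digraph \<Rightarrow> 'a list \<Rightarrow> bool" where
  "undirected_cycle G c \<longleftrightarrow> vpath c G \<and> 3 \<le> length c \<and> last c \<rightarrow>\<^bsub>G\<^esub> hd c"

definition undirected_tree :: "('a, 'b) pre_digraph \<Rightarrow> bool" where
  "undirected_tree T \<longleftrightarrow> graph T \<and> connected T \<and> \<not> (\<exists>c. undirected_cycle T c)"

definition undirected_spanning_tree :: "('a, 'b) pre_digraph \<Rightarrow> ('a, 'b) pre_digraph \<Rightarrow> bool" where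
  "undirected_spanning_tree T G \<longleftrightarrow> undirected_tree T \<and> spanning T G"

datatype sign = Plus | Minus

text \<open>
  A labelling of the edges of \<open>T\<close> is a total function on vertex sets, of which only the values on
  edges of \<open>T\<close> are ever used. When \<open>T\<close> is a spanning tree of \<open>G\<close>, the path \<open>p\<close> below exists and
  is unique for each cotree edge \<open>{u, v}\<close> and each choice of its first vertex.
\<close>

definition alternating_sign ::
  "('a, 'b) pre_digraph \<Rightarrow> ('a, 'b) pre_digraph \<Rightarrow> ('a set \<Rightarrow> sign) \<Rightarrow> bool" where
  "alternating_sign G T \<phi> \<longleftrightarrow>
    (\<forall>u v. u \<rightarrow>\<^bsub>G\<^esub> v \<and> \<not> u \<rightarrow>\<^bsub>T\<^esub> v \<longrightarrow>
      (\<forall>p. vpath p T \<and> hd p = u \<and> last p = v \<longrightarrow>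
        (\<forall>i. i + 2 < length p \<longrightarrow> \<phi> {p ! i, p ! (i + 1)} \<noteq> \<phi> {p ! (i + 1), p ! (i + 2)})))"

end

theory Submission
  imports Defs
begin

text \<open>
  Among all rooted spanning trees, one with maximal sum of depths is a depth-first search tree:
  if a cotree edge \<open>{u, v}\<close> with \<open>depth u \<le> depth v\<close> joined vertices neither of which is an ancestor
  of the other, then making \<open>v\<close> the parent of \<open>u\<close> would push the whole subtree of \<open>u\<close> further down.
  So each cotree edge joins a vertex to one of its ancestors, the tree path between them is
  monotone in depth, and labelling each tree edge by the parity of its depth alternates along it.
\<close>

lemma vwalk_nth_adj:
  assumes "vwalk p G" "Suc i < length p"
  shows "p ! i \<rightarrow>\<^bsub>G\<^esub> p ! Suc i"
  using assms
proof (induction arbitrary: i)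
  case (Cons u v es)
  then show ?case by (cases i) auto
qed simp

text \<open>The equation for \<open>depth\<close> rules out cycles of \<open>parent\<close> other
  than the loop at \<open>root\<close>: each step from another vertex lowers the depth by one, so
  iteration reaches \<open>root\<close>. Making \<open>root\<close> a fixed point keeps all iterates
  inside the tree.\<close>

locale rooted_spanning_tree = graph G for G :: "('a, 'b) pre_digraph" (structure) +
  fixes root :: 'a and parent :: "'a \<Rightarrow> 'a" and depth :: "'a \<Rightarrow> nat"
  assumes root_in_verts: "root \<in> verts G"
    and parent_root: "parent root = root"
    and depth_root: "depth root = 0"
    and adj_parent: "v \<in> verts G \<Longrightarrow> v \<noteq> root \<Longrightarrow> v \<rightarrow> parent v"
    and depth_parent: "v \<in> verts G \<Longrightarrow> v \<noteq> root \<Longrightarrow> depth v = Suc (depth (parent v))"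
begin

definition ancestor :: "'a \<Rightarrow> 'a \<Rightarrow> bool" where
  "ancestor u v \<longleftrightarrow> (\<exists>n. (parent ^^ n) v = u)"

text \<open>Excluding \<open>root\<close> keeps the fixed point of \<open>parent\<close> from
  becoming a loop edge.\<close>

definition child :: "'a \<Rightarrow> 'a \<Rightarrow> bool" where
  "child u v \<longleftrightarrow> u \<in> verts G \<and> u \<noteq> root \<and> parent u = v"

definition tree_graph :: "('a, 'b) pre_digraph" where
  "tree_graph = G\<lparr>arcs := {e \<in> arcs G. child (tail G e) (head G e) \<or> child (head G e) (tail G e)}\<rparr>"

text \<open>The ends of a tree edge differ by one in depth, so \<open>Min\<close> selects the depth
  of the parent end.\<close>

definition parity_sign :: "'a set \<Rightarrow> sign" where
  "parity_sign e = (if even (Min (depth ` e)) then Plus else Minus)"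

lemma parent_in_verts: "v \<in> verts G \<Longrightarrow> parent v \<in> verts G"
  using adj_parent parent_root by (metis adj_in_verts(2))

lemma child_depth: "child u v \<Longrightarrow> depth u = Suc (depth v)"
  by (auto simp: child_def depth_parent)

lemma child_unique: "child u v \<Longrightarrow> child u w \<Longrightarrow> v = w"
  by (simp add: child_def)

section \<open>Ancestors and depth\<close>

lemma ancestor_refl: "ancestor v v"
  unfolding ancestor_def by (metis funpow_0)

lemma child_ancestor: "child u v \<Longrightarrow> ancestor v u"
  unfolding ancestor_def child_def by (metis funpow_0 funpow_simps_right(2) o_apply)

lemma ancestor_trans: "ancestor u v \<Longrightarrow> ancestor v w \<Longrightarrow> ancestor u w"
  unfolding ancestor_def by (metis funpow_add o_apply)

lemma ancestor_parent_iff: "w \<noteq> u \<Longrightarrow> ancestor u (parent w) \<longleftrightarrow> ancestor u w"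
  unfolding ancestor_def by (metis funpow_0 funpow_simps_right(2) o_apply not0_implies_Suc)

lemma ancestor_root_iff: "ancestor u root \<longleftrightarrow> u = root"
proof -
  have "(parent ^^ n) root = root" for n
    by (induction n) (simp_all add: parent_root)
  then show ?thesis by (auto simp: ancestor_def)
qed

lemma root_ancestor: "v \<in> verts G \<Longrightarrow> ancestor root v"
proof (induction "depth v" arbitrary: v)
  case 0
  then show ?case by (metis depth_parent nat.distinct(1) ancestor_refl)
next
  case (Suc n)
  then show ?case
    by (metis Suc_inject depth_parent parent_in_verts ancestor_parent_iff ancestor_refl)
qed

text \<open>Since \<open>parent\<close> fixes \<open>root\<close>, the number of steps to an
  ancestor is determined only when that ancestor is not \<open>root\<close>.\<close>

lemma ancestor_depth:
  assumes "v \<in> verts G" "(parent ^^ n) v = u" "u \<noteq> root"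
  shows "depth v = depth u + n"
  using assms
proof (induction n arbitrary: v)
  case (Suc n)
  then have "v \<noteq> root"
    using ancestor_root_iff ancestor_def by metis
  moreover have "depth (parent v) = depth u + n"
    using Suc parent_in_verts by (simp add: funpow_swap1)
  ultimately show ?case using Suc depth_parent by simp
qed simp

lemma ancestor_eqI:
  assumes "v \<in> verts G" "ancestor u v" "ancestor w v" "depth u = depth w" "u \<noteq> root" "w \<noteq> root"
  shows "u = w"
proof -
  obtain m n where "(parent ^^ m) v = u" "(parent ^^ n) v = w"
    using assms unfolding ancestor_def by blast
  then show ?thesis using ancestor_depth assms by (metis add_left_imp_eq)
qed

text \<open>The parent chain from \<open>v\<close> realises every depth from \<open>depth v\<close>
  down to 0. This bounds the total depth, so a maximum exists.\<close>

lemma depth_less_card: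
  assumes "v \<in> verts G"
  shows "depth v < card (verts G)"
proof -
  have "{..depth v} \<subseteq> depth ` verts G"
    using assms
  proof (induction "depth v" arbitrary: v)
    case 0
    then show ?case by auto
  next
    case (Suc n)
    then have "v \<noteq> root" using depth_root by auto
    with Suc have "depth (parent v) = n" "parent v \<in> verts G"
      using depth_parent parent_in_verts by auto
    with Suc(1) have "{..n} \<subseteq> depth ` verts G" by blast
    moreover have "{..depth v} = insert (depth v) {..n}" using Suc(2) by auto
    ultimately show ?case using Suc.prems by auto
  qed
  then have "card {..depth v} \<le> card (verts G)"
    by (meson card_image_le card_mono finite_imageI finite_verts le_trans)
  then show ?thesis by simp
qed

text \<open>The subtree of \<open>u\<close> sinks as a block, so depth differences inside it
  persist. As \<open>u\<close> is no ancestor of \<open>v\<close>, the depth of \<open>v\<close> is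
  unchanged; \<open>depth u \<le> depth v\<close> makes the natural subtraction exact and
  positive.\<close>

lemma reattach:
  assumes "u \<rightarrow> v" "\<not> ancestor u v" "depth u \<le> depth v"
  shows "rooted_spanning_tree G root (parent(u := v))
    (\<lambda>w. depth w + (if ancestor u w then Suc (depth v) - depth u else 0))"
proof -
  have "u \<in> verts G" "v \<in> verts G" using assms(1) by (auto intro: adj_in_verts)
  have "u \<noteq> root" using assms(2) root_ancestor \<open>v \<in> verts G\<close> by auto
  then have "\<not> ancestor u root" by (simp add: ancestor_root_iff)
  show ?thesis
    using assms \<open>u \<noteq> root\<close> \<open>\<not> ancestor u root\<close> root_in_verts parent_root depth_root adj_parent
      depth_parent ancestor_refl ancestor_parent_iff
    by unfold_locales auto
qed

section \<open>The parent edges as an undirected spanning tree\<close>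

lemma tree_adj_iff: "u \<rightarrow>\<^bsub>tree_graph\<^esub> v \<longleftrightarrow> u \<rightarrow> v \<and> (child u v \<or> child v u)"
  unfolding tree_graph_def arcs_ends_conv by auto

lemma child_tree_adj: "child u v \<Longrightarrow> u \<rightarrow>\<^bsub>tree_graph\<^esub> v"
  using adj_parent by (auto simp: tree_adj_iff child_def)

lemma verts_tree_graph [simp]: "verts tree_graph = verts G"
  by (simp add: tree_graph_def)

lemma graph_tree_graph: "graph tree_graph"
proof -
  have "sym (arcs_ends tree_graph)"
    using graph_symmetric by (auto simp: sym_def tree_adj_iff)
  then show ?thesis
    by unfold_locales
      (auto simp: tree_graph_def symmetric_def no_loops arc_to_ends_def intro: no_multi_arcs)
qed

lemma spanning_tree_graph: "spanning tree_graph G"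
  using graph_tree_graph wf_digraph
  by (auto simp: spanning_def subgraph_def compatible_def tree_graph_def graph_def digraph_def
      fin_digraph_def)

lemma connected_tree_graph: "connected tree_graph"
proof -
  interpret T: graph tree_graph by (rule graph_tree_graph)
  have to_root: "v \<rightarrow>\<^sup>*\<^bsub>tree_graph\<^esub> root" if "v \<in> verts G" for v
    using that
  proof (induction "depth v" arbitrary: v)
    case 0
    then have "v = root" using depth_parent by fastforce
    then show ?case using root_in_verts by simp
  next
    case (Suc n)
    then have "child v (parent v)" using depth_root by (auto simp: child_def)
    moreover have "parent v \<rightarrow>\<^sup>*\<^bsub>tree_graph\<^esub> root"
      using Suc calculation child_depth parent_in_verts by (metis Suc_inject)
    ultimately show ?case
      using child_tree_adj T.adj_reachable_trans by blast
  qed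
  have "u \<rightarrow>\<^sup>*\<^bsub>tree_graph\<^esub> v" if "u \<in> verts G" "v \<in> verts G" for u v
    using to_root that T.reachable_trans T.symmetric_reachable' by meson
  then show ?thesis
    using root_in_verts T.sym_arcs unfolding connected_def
    by (intro strongly_connectedI) (auto simp: T.reachable_mk_symmetric_eq)
qed

lemma tree_adj_le_depth:
  assumes "u \<rightarrow>\<^bsub>tree_graph\<^esub> v" "depth v \<le> depth u"
  shows "child u v"
  using assms child_depth by (fastforce simp: tree_adj_iff)

text \<open>At a vertex of maximal depth on a cycle, both neighbours would have to be its unique
  parent, yet they are distinct on a cycle of length at least 3.\<close>

lemma no_cycle_tree_graph: "\<not> undirected_cycle tree_graph c"
proof
  assume cycle: "undirected_cycle tree_graph c"
  interpret T: graph tree_graph by (rule graph_tree_graph)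
  let ?n = "length c"
  have c: "vwalk c tree_graph" "distinct c" "3 \<le> ?n" "last c \<rightarrow>\<^bsub>tree_graph\<^esub> hd c"
    using cycle by (auto simp: undirected_cycle_def)
  \<comment> \<open>Indices modulo the length treat the closing arc like any other step.\<close>
  have next_adj: "c ! i \<rightarrow>\<^bsub>tree_graph\<^esub> c ! (Suc i mod ?n)" if "i < ?n" for i
  proof (cases "Suc i = ?n")
    case True
    have "c \<noteq> []" using c(3) by auto
    then have "c ! (?n - 1) = last c" "c ! 0 = hd c"
      by (simp_all add: last_conv_nth hd_conv_nth)
    moreover have "?n - 1 = i" using True by simp
    ultimately have "c ! i = last c" "c ! 0 = hd c" by simp_all
    then show ?thesis using c(4) True by simp
  next
    case False
    then show ?thesis using vwalk_nth_adj[OF c(1)] that by simp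
  qed
  obtain m where m: "m < ?n" "\<And>j. j < ?n \<Longrightarrow> depth (c ! j) \<le> depth (c ! m)"
  proof -
    have "finite (depth ` set c)" "depth ` set c \<noteq> {}" using c(3) by auto
    then have "Max (depth ` set c) \<in> depth ` set c" by (rule Max_in)
    then obtain x where "x \<in> set c" "depth x = Max (depth ` set c)"
      by (metis imageE)
    moreover from this(1) obtain m where "m < ?n" "c ! m = x"
      by (auto simp: in_set_conv_nth)
    ultimately show ?thesis by (intro that[of m]) simp_all
  qed
  \<comment> \<open>\<open>k\<close> is the cyclic predecessor of \<open>m\<close>.\<close>
  define k where "k = (if m = 0 then ?n - 1 else m - 1)"
  have k: "k < ?n" "Suc k mod ?n = m" using m(1) c(3) by (auto simp: k_def)
  have l: "Suc m mod ?n < ?n" using c(3) by (intro mod_less_divisor) linarith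
  have "child (c ! m) (c ! (Suc m mod ?n))"
    using next_adj m l by (intro tree_adj_le_depth) auto
  moreover have "child (c ! m) (c ! k)"
    using next_adj[of k] m k T.graph_symmetric by (intro tree_adj_le_depth) auto
  ultimately have "c ! (Suc m mod ?n) = c ! k" by (rule child_unique)
  then have "Suc m mod ?n = k" using c(2) k(1) l by (simp add: nth_eq_iff_index_eq)
  moreover have "Suc m mod ?n = (if Suc m = ?n then 0 else Suc m)" using m(1) by simp
  ultimately show False
    unfolding k_def using m(1) c(3) by (simp split: if_splits)
qed

lemma undirected_spanning_tree_graph: "undirected_spanning_tree tree_graph G"
  using graph_tree_graph connected_tree_graph no_cycle_tree_graph spanning_tree_graph
  by (simp add: undirected_spanning_tree_def undirected_tree_def)

section \<open>Depth profile of tree paths\<close>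

context
  fixes p
  assumes p: "vpath p tree_graph"
begin

lemma path_step:
  assumes "Suc i < length p"
  shows "child (p ! i) (p ! Suc i) \<or> child (p ! Suc i) (p ! i)"
  using vwalk_nth_adj[of p tree_graph i] p assms by (auto simp: vpath_def tree_adj_iff)

lemma path_no_local_max:
  assumes "Suc (Suc i) < length p" "child (p ! Suc i) (p ! i)" "child (p ! Suc i) (p ! Suc (Suc i))"
  shows False
proof -
  have "p ! i = p ! Suc (Suc i)" using child_unique assms by blast
  then show False using p assms(1) by (simp add: vpath_def nth_eq_iff_index_eq)
qed

text \<open>Once a path steps away from the root it never turns back, as the turn would be a local
  maximum of depth.\<close>

lemma path_descending:
  assumes "Suc i < length p" "child (p ! Suc i) (p ! i)" "Suc i + j < length p"
  shows "child (p ! (Suc i + j)) (p ! (i + j)) \<and> ancestor (p ! Suc i) (p ! (Suc i + j))"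
  using assms(3)
proof (induction j)
  case 0
  then show ?case using assms ancestor_refl by simp
next
  case (Suc j)
  then have "child (p ! Suc (Suc (i + j))) (p ! Suc (i + j))"
    using path_step[of "Suc (i + j)"] path_no_local_max[of "i + j"] by auto
  with Suc show ?case
    using child_ancestor ancestor_trans by (metis Suc_lessD add_Suc add_Suc_right)
qed

text \<open>The mirror image of \<open>path_descending\<close>, read backwards from position
  \<open>i\<close>.\<close>

lemma path_ascending:
  assumes "Suc i < length p" "child (p ! i) (p ! Suc i)" "j \<le> i"
  shows "child (p ! (i - j)) (p ! Suc (i - j)) \<and> ancestor (p ! i) (p ! (i - j))"
  using assms(3)
proof (induction j)
  case 0
  then show ?case using assms ancestor_refl by simp
next
  case (Suc j)
  then have i: "i - j = Suc (i - Suc j)" by simp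
  with Suc have IH: "child (p ! Suc (i - Suc j)) (p ! Suc (Suc (i - Suc j)))"
    "ancestor (p ! i) (p ! Suc (i - Suc j))" by simp_all
  moreover have "Suc (Suc (i - Suc j)) < length p" using Suc.prems assms(1) by simp
  then have "child (p ! (i - Suc j)) (p ! Suc (i - Suc j))"
    using path_step[of "i - Suc j"] path_no_local_max[of "i - Suc j"] IH(1) by auto
  ultimately show ?case
    using child_ancestor ancestor_trans by blast
qed

text \<open>Around a local minimum of depth, the vertex before it is an ancestor of
  \<open>hd p\<close> and the vertex after it one of \<open>last p\<close>. If the ends are
  comparable, both are ancestors of the lower end; having equal depth they coincide, against
  distinctness.\<close>

lemma path_no_local_min:
  assumes "Suc (Suc i) < length p" "child (p ! i) (p ! Suc i)" "child (p ! Suc (Suc i)) (p ! Suc i)"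
    and comparable: "ancestor (hd p) (last p) \<or> ancestor (last p) (hd p)"
  shows False
proof -
  have "p \<noteq> []" "set p \<subseteq> verts G" "distinct p"
    using p by (auto simp: vpath_def vwalk_def)
  then have ends: "hd p \<in> verts G" "last p \<in> verts G" by auto
  have "ancestor (p ! i) (hd p)"
    using path_ascending[of i i] assms \<open>p \<noteq> []\<close> by (simp add: hd_conv_nth)
  moreover have "ancestor (p ! Suc (Suc i)) (last p)"
  proof -
    obtain j where "length p = Suc (Suc (Suc i) + j)"
      using assms(1) less_imp_Suc_add by blast
    then show ?thesis
      using path_descending[of "Suc i" j] assms \<open>p \<noteq> []\<close> by (simp add: last_conv_nth)
  qed
  moreover have "depth (p ! i) = depth (p ! Suc (Suc i))" "p ! i \<noteq> root" "p ! Suc (Suc i) \<noteq> root"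
    using assms child_depth by (auto simp: child_def)
  ultimately have "p ! i = p ! Suc (Suc i)"
    using comparable ancestor_eqI ancestor_trans ends by meson
  then show False using \<open>distinct p\<close> assms(1) by (simp add: nth_eq_iff_index_eq)
qed

text \<open>Without local extrema of depth, two consecutive edges run in the same direction, so
  their parent ends have consecutive depths.\<close>

lemma path_alternating:
  assumes "Suc (Suc i) < length p" "ancestor (hd p) (last p) \<or> ancestor (last p) (hd p)"
  shows "parity_sign {p ! i, p ! Suc i} \<noteq> parity_sign {p ! Suc i, p ! Suc (Suc i)}"
proof -
  have "child (p ! i) (p ! Suc i) \<and> child (p ! Suc i) (p ! Suc (Suc i)) \<or>
      child (p ! Suc i) (p ! i) \<and> child (p ! Suc (Suc i)) (p ! Suc i)"
    using path_step[of i] path_step[of "Suc i"] path_no_local_max path_no_local_min assms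
      Suc_lessD by blast
  then show ?thesis
    by (auto dest!: child_depth simp: parity_sign_def)
qed

end

lemma alternating_parity_sign:
  assumes "\<And>u v. u \<rightarrow> v \<Longrightarrow> ancestor u v \<or> ancestor v u"
  shows "alternating_sign G tree_graph parity_sign"
  using path_alternating assms by (auto simp: alternating_sign_def)

end

text \<open>Breadth-first distances give a first rooted spanning tree.\<close>

lemma (in graph) ex_rooted_spanning_tree:
  assumes "connected G"
  shows "\<exists>root parent depth. rooted_spanning_tree G root parent depth"
proof -
  have sc: "strongly_connected G"
    using assms sym_arcs by (intro symmetric_connected_imp_strongly_connected)
  then obtain r where r: "r \<in> verts G" by (auto simp: strongly_connected_def)
  let ?R = "arcs_ends G"
  define d where "d v = (LEAST n. (r, v) \<in> ?R ^^ n)" for v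
  have d: "(r, v) \<in> ?R ^^ d v" if "v \<in> verts G" for v
  proof -
    have "(r, v) \<in> ?R\<^sup>*"
      using sc r that by (auto simp: strongly_connected_def reachable_conv)
    then show ?thesis unfolding d_def by (meson LeastI rtrancl_imp_relpow)
  qed
  have d_le: "d v \<le> n" if "(r, v) \<in> ?R ^^ n" for v n
    unfolding d_def using that by (rule Least_le)
  have d_r: "d r = 0" using d_le[of r 0] by simp
  have "\<exists>w. v \<rightarrow> w \<and> d v = Suc (d w)" if v: "v \<in> verts G" "v \<noteq> r" for v
  proof -
    obtain m where m: "d v = Suc m"
      using d[OF v(1)] v(2) by (cases "d v") auto
    then obtain w where w: "(r, w) \<in> ?R ^^ m" "w \<rightarrow> v"
      using d[OF v(1)] by auto
    then have "w \<in> verts G" by (auto intro: adj_in_verts)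
    \<comment> \<open>The walk to \<open>w\<close> gives \<open>d w \<le> m\<close>, and extending a
      shortest one to \<open>v\<close> gives \<open>Suc m \<le> Suc (d w)\<close>.\<close>
    then have "(r, v) \<in> ?R ^^ Suc (d w)" using d w(2) by auto
    then have "d v = Suc (d w)" using d_le w(1) m by (metis Suc_le_mono le_antisym)
    then show ?thesis using w(2) graph_symmetric by blast
  qed
  then obtain f where f: "\<And>v. v \<in> verts G \<Longrightarrow> v \<noteq> r \<Longrightarrow> v \<rightarrow> f v \<and> d v = Suc (d (f v))"
    by metis
  \<comment> \<open>\<open>f\<close> is unconstrained at \<open>r\<close>; the update makes
    \<open>r\<close> a fixed point.\<close>
  have "rooted_spanning_tree G r (f(r := r)) d"
    using r d_r f by unfold_locales auto
  then show ?thesis by blast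
qed

section \<open>Rooted trees of maximal total depth\<close>

lemma (in graph) ex_depth_first_tree:
  assumes "connected G"
  shows "\<exists>root parent depth. rooted_spanning_tree G root parent depth \<and>
    (\<forall>u v. u \<rightarrow> v \<longrightarrow> rooted_spanning_tree.ancestor parent u v \<or>
      rooted_spanning_tree.ancestor parent v u)"
proof -
  obtain root parent0 depth0 where "rooted_spanning_tree G root parent0 depth0"
    using ex_rooted_spanning_tree[OF assms] by blast
  \<comment> \<open>The maximum is taken with \<open>root\<close> fixed, which suffices because
    \<open>reattach\<close> keeps the root.\<close>
  let ?P = "\<lambda>(parent, depth). rooted_spanning_tree G root parent depth"
  let ?f = "\<lambda>(parent :: 'a \<Rightarrow> 'a, depth). \<Sum>v\<in>verts G. depth v"
  have bound: "?f x < Suc (card (verts G) * card (verts G))" if "?P x" for x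
  proof -
    obtain par dep where x: "x = (par, dep)" by fastforce
    with that have "dep v \<le> card (verts G)" if "v \<in> verts G" for v
      using that rooted_spanning_tree.depth_less_card by (fastforce intro: less_imp_le)
    then show ?thesis
      using sum_bounded_above[of "verts G" dep "card (verts G)"] x by simp
  qed
  have "?P (parent0, depth0)"
    using \<open>rooted_spanning_tree G root parent0 depth0\<close> by simp
  then have "\<exists>x. ?P x \<and> (\<forall>y. ?P y \<longrightarrow> ?f y \<le> ?f x)"
    using bound by (rule ex_has_greatest_nat[OF _ allI[OF impI]])
  then obtain parent depth where tree: "rooted_spanning_tree G root parent depth"
    and max: "\<And>par' dep'. rooted_spanning_tree G root par' dep' \<Longrightarrow>
      (\<Sum>v\<in>verts G. dep' v) \<le> (\<Sum>v\<in>verts G. depth v)"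
    by auto
  interpret rooted_spanning_tree G root parent depth by (rule tree)
  have anc: "ancestor u v" if "u \<rightarrow> v" "depth u \<le> depth v" for u v
  proof (rule ccontr)
    assume "\<not> ancestor u v"
    let ?dep = "\<lambda>w. depth w + (if ancestor u w then Suc (depth v) - depth u else 0)"
    \<comment> \<open>No summand drops, and the one at \<open>u\<close> grows because
      \<open>u\<close> is its own ancestor.\<close>
    have "(\<Sum>w\<in>verts G. depth w) < (\<Sum>w\<in>verts G. ?dep w)"
      using that adj_in_verts(1) ancestor_refl
      by (intro sum_strict_mono_ex1) (auto intro!: bexI[of _ u])
    moreover have "(\<Sum>w\<in>verts G. ?dep w) \<le> (\<Sum>w\<in>verts G. depth w)"
      using max[OF reattach[OF that(1) \<open>\<not> ancestor u v\<close> that(2)]] .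
    ultimately show False by simp
  qed
  have "ancestor u v \<or> ancestor v u" if "u \<rightarrow> v" for u v
    using anc that graph_symmetric nat_le_linear by metis
  with tree show ?thesis by blast
qed

theorem theorem2p2:
  fixes G :: "('a, 'b) pre_digraph"
  assumes "graph G"
    and "connected G"
  shows "\<exists>T \<phi>. undirected_spanning_tree T G \<and> alternating_sign G T \<phi>"
proof -
  obtain root parent depth where tree: "rooted_spanning_tree G root parent depth"
    and anc: "\<And>u v. u \<rightarrow>\<^bsub>G\<^esub> v \<Longrightarrow> rooted_spanning_tree.ancestor parent u v \<or>
      rooted_spanning_tree.ancestor parent v u"
    using graph.ex_depth_first_tree[OF assms] by blast
  interpret rooted_spanning_tree G root parent depth by (rule tree)
  show ?thesis
    using undirected_spanning_tree_graph alternating_parity_sign[OF anc] by blast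
qed

end
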